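(* Let $m,i,j$ be positive integers and let $q=2^m$, $Q_1=2^i$, $Q_2=2^j$. The polynomial $$f_B(x)=x^{q(Q_1+Q_2)+1}+x^{q(Q_1+1)+Q_2}+x^{qQ_1+Q_2+1}+x^{q(Q_2+1)+Q_1}+x^{Q_1+Q_2+1}\in\mathbb{F}_{q^2}[x]$$ is a permutation of $\mathbb{F}_{q^2}$ if and only if one of the following holds: (i) $m$ is odd, $i(j+1)\equiv 1\pmod 2$, and $\gcd(Q_1+Q_2+1,q-1)=1$; moreover, in this case $f_B$ is linear equivalent to the function $(u,v)\mapsto(u^{Q_1+Q_2+1},v^{Q_1+Q_2+1})$ from $\mathbb{F}_q^2$ to $\mathbb{F}_q^2$; (ii) $m$ is even and $\gcd(Q_1+Q_2+1,q-1)=\gcd(Q_1+Q_2+1-2r_B,q+1)=1$, where the integer $r_B$ is defined by: $r_B=0$ if $i\equiv 1$, $j\equiv 0\pmod 2$; $r_B=1$ if $i\equiv 0$, $j\equiv 1\pmod 2$; $r_B=Q_1$ if $i\equiv j\equiv 0\pmod 2$ and $Q_1\le Q_2$; $r_B=Q_2+1$ if $i\equiv j\equiv 0\pmod 2$ and $Q_1>Q_2$; $r_B=Q_1+1$ if $i\equiv j\equiv 1\pmod 2$ and $Q_1<Q_2$; $r_B=Q_2$ if $i\equiv j\equiv 1\pmod 2$ and $Q_1\ge Q_2$. Moreover, in this case $f_B$ is linear equivalent to the function $x\mapsto x^{Q_1+Q_2+1+r_B(q-1)}$ on $\mathbb{F}_{q^2}$.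
   Context: A map is called linear here if it is additive (i.e. $\mathbb{F}_2$-linear). A function $F$ on $\mathbb{F}_{q^2}$ is linear equivalent to a function $P:X\to X$ (where $X=\mathbb{F}_{q^2}$ or $X=\mathbb{F}_q^2$) if $F=L_1\circ P\circ L_2$ for some additive bijections $L_2:\mathbb{F}_{q^2}\to X$ and $L_1:X\to\mathbb{F}_{q^2}$. *)

theory Defs
  imports
    "HOL-Library.FuncSet"
    "HOL-Computational_Algebra.Polynomial"
    "HOL-Library.Cardinality"
    "HOL-Library.Product_Plus"
    "HOL-Number_Theory.Cong"
begin

definition f_B :: "nat \<Rightarrow> nat \<Rightarrow> nat \<Rightarrow> 'a::comm_semiring_1 poly" where
  "f_B q Q1 Q2 =
     monom 1 (q * (Q1 + Q2) + 1) + monom 1 (q * (Q1 + 1) + Q2) + monom 1 (q * Q1 + Q2 + 1)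
     + monom 1 (q * (Q2 + 1) + Q1) + monom 1 (Q1 + Q2 + 1)"

(* Applied in a field with q^2 elements, where this is the subfield F_q. *)
definition subfield_Fq :: "nat \<Rightarrow> 'a::monoid_mult set" where
  "subfield_Fq q = {x. x ^ q = x}"

definition additive_bij_betw :: "('a::plus \<Rightarrow> 'b::plus) \<Rightarrow> 'a set \<Rightarrow> 'b set \<Rightarrow> bool" where
  "additive_bij_betw L A B \<longleftrightarrow>
     bij_betw L A B \<and> (\<forall>x\<in>A. \<forall>y\<in>A. L (x + y) = L x + L y)"

(* F, a function on the whole type, is linear equivalent to P : X -> X. *)
definition linear_equivalent :: "('a::plus \<Rightarrow> 'a) \<Rightarrow> 'b::plus set \<Rightarrow> ('b \<Rightarrow> 'b) \<Rightarrow> bool" where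
  "linear_equivalent F X P \<longleftrightarrow>
     P \<in> X \<rightarrow> X \<and>
     (\<exists>L1 L2. additive_bij_betw L2 UNIV X \<and> additive_bij_betw L1 X UNIV \<and> F = L1 \<circ> P \<circ> L2)"

(* All values are nonnegative, so r_B is a nat; but Q1 + Q2 + 1 - 2 r_B can be negative and
   must be formed in int. *)
definition r_B :: "nat \<Rightarrow> nat \<Rightarrow> nat" where
  "r_B i j =
     (let Q1 = 2 ^ i; Q2 = 2 ^ j in
      if odd i \<and> even j then 0
      else if even i \<and> odd j then 1
      else if even i \<and> even j then (if Q1 \<le> Q2 then Q1 else Q2 + 1)
      else (if Q1 < Q2 then Q1 + 1 else Q2))"

end

theory Submission
  imports Defs
begin

text \<open>
  Write \<open>a = x^Q1\<close>, \<open>b = x^Q2\<close>, \<open>c = x\<close> and let a bar denote the \<open>q\<close>-th power. Then \<open>f_B\<close> is a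
  trilinear form in the pairs \<open>(a, bar a)\<close>, \<open>(b, bar b)\<close>, \<open>(c, bar c)\<close>. For a primitive cube root
  of unity \<open>w\<close>, this \<open>2 \<times> 2 \<times> 2\<close> tensor is a sum of two products of linear forms: its two slices
  \<open>M\<close>, \<open>N\<close> satisfy \<open>det (k M + l N) = k^2 + k l + l^2\<close>, which vanishes at
  \<open>k = w l\<close> and \<open>k = w^2 l\<close>. The linear forms in this decomposition are powers of
  \<open>s = x + w bar x\<close> and \<open>t = x + w^2 bar x\<close>, since raising to a power of two fixes or swaps
  \<open>w\<close> and \<open>w^2\<close>.

  If \<open>m\<close> is odd, \<open>s\<close> and \<open>t\<close> are, up to constants, independent coordinates in the subfield, and
  \<open>f_B\<close> splits as a pair of powers unless the parities of \<open>i\<close> and \<open>j\<close> are wrong, in which case it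
  vanishes at \<open>w\<close>. If \<open>m\<close> is even, \<open>s\<close> and \<open>t\<close> are conjugate up to a constant, and \<open>f_B\<close> has the form
  \<open>z + w^2 bar z\<close> with \<open>z\<close> a monomial in \<open>t\<close>. It remains to determine when power maps are injective.
\<close>

section \<open>Roots of unity and injectivity of power maps in a finite field\<close>

lemma power_card_minus_1:
  fixes x :: "'a::{field,finite}"
  assumes "x \<noteq> 0"
  shows "x ^ (CARD('a) - 1) = 1"
proof -
  define P where "P = \<Prod>(UNIV - {0::'a})"
  have "bij_betw (\<lambda>y. x * y) (UNIV - {0}) (UNIV - {0})"
    by (rule bij_betw_byWitness[where f' = "\<lambda>y. y / x"]) (use assms in auto)
  then have "P = (\<Prod>y\<in>UNIV - {0}. x * y)"
    unfolding P_def by (rule prod.reindex_bij_betw[symmetric])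
  also have "\<dots> = x ^ (CARD('a) - 1) * P"
    by (simp add: prod.distrib P_def card_Diff_singleton)
  finally show ?thesis
    by (simp add: P_def)
qed

lemma power_card:
  fixes x :: "'a::{field,finite}"
  shows "x ^ CARD('a) = x"
proof (cases "x = 0")
  case False
  have "x ^ CARD('a) = x * x ^ (CARD('a) - 1)"
    by (rule power_eq_if[THEN trans]) simp
  then show ?thesis
    by (simp only: power_card_minus_1[OF False] mult_1_right)
qed simp

text \<open>With \<open>CARD('a) - 1 = d * n\<close>, the polynomial \<open>X^n - 1\<close> has at
  most \<open>n\<close> roots, too few to cover all nonzero elements when \<open>d > 1\<close>. For
  a nonzero non-root \<open>x\<close>, the power \<open>x ^ n\<close> is the required
  element.\<close>

lemma exists_root_of_unity:
  fixes d :: nat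
  assumes "d dvd CARD('a::{field,finite}) - 1" and "d > 1"
  shows "\<exists>y::'a. y \<noteq> 1 \<and> y ^ d = 1"
proof -
  have "finite (UNIV :: 'a set)" "{0, 1 :: 'a} \<subseteq> UNIV" by auto
  from card_mono[OF this] have two: "CARD('a) \<ge> 2" by simp
  obtain n where n: "CARD('a) - 1 = d * n"
    using assms by (elim dvdE)
  have "n > 0" using n two by (intro Nat.gr0I) auto
  define p :: "'a poly" where "p = monom 1 n - 1"
  have "coeff p n = 1" using \<open>n > 0\<close> by (simp add: p_def)
  then have "p \<noteq> 0" by auto
  have "degree p \<le> n" unfolding p_def by (intro degree_diff_le) (auto simp: degree_monom_le)
  have "card {x. poly p x = 0} < CARD('a) - 1"
  proof -
    have "card {x. poly p x = 0} \<le> degree p" using \<open>p \<noteq> 0\<close> by (rule card_poly_roots_bound)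
    also have "\<dots> \<le> n" by fact
    also have "\<dots> < CARD('a) - 1" using n \<open>n > 0\<close> \<open>d > 1\<close> by simp
    finally show ?thesis .
  qed
  then have "\<not> UNIV - {0} \<subseteq> {x. poly p x = 0}"
    using card_mono[of "{x. poly p x = 0}" "UNIV - {0}"] by (auto simp: card_Diff_singleton)
  then obtain x where x: "x \<noteq> 0" "poly p x \<noteq> 0" by auto
  have "(x ^ n) ^ d = 1"
    using power_card_minus_1[OF x(1)] unfolding n by (simp add: mult.commute flip: power_mult)
  moreover have "x ^ n \<noteq> 1" using x(2) by (simp add: p_def poly_monom)
  ultimately show ?thesis by blast
qed

text \<open>The set consists of 0 and the \<open>n\<close>-th roots of unity. A nontrivial root of
  unity of order dividing \<open>gcd e n\<close> would have the same \<open>e\<close>-th power as 1;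
  conversely, if \<open>e\<close> and \<open>n\<close> are coprime, Bezout forces a quotient killed
  by both exponents to be 1. The form with \<open>Suc n\<close> covers both the subfield and the
  whole field.\<close>

lemma inj_on_power_subfield_iff:
  assumes "n dvd CARD('a::{field,finite}) - 1" and "n > 0" and "e > 0"
  shows "inj_on (\<lambda>x::'a. x ^ e) (subfield_Fq (Suc n)) \<longleftrightarrow> coprime e n"
proof
  assume inj: "inj_on (\<lambda>x::'a. x ^ e) (subfield_Fq (Suc n))"
  show "coprime e n"
  proof (rule ccontr)
    assume "\<not> coprime e n"
    then have "gcd e n > 1"
      using \<open>n > 0\<close> by (metis coprime_iff_gcd_eq_1 gcd_pos_nat less_one nat_neq_iff)
    moreover have "gcd e n dvd CARD('a) - 1"
      using assms(1) by (meson dvd_trans gcd_dvd2)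
    ultimately obtain y :: 'a where y: "y \<noteq> 1" "y ^ gcd e n = 1"
      using exists_root_of_unity by blast
    have "y ^ k = 1" if "gcd e n dvd k" for k
      using that y(2) by (auto elim!: dvdE simp: power_mult)
    then have "y ^ e = 1" "y ^ n = 1" by simp_all
    then have "y = 1"
      by (intro inj_onD[OF inj, of y 1]) (auto simp: subfield_Fq_def)
    with y(1) show False ..
  qed
next
  assume "coprime e n"
  show "inj_on (\<lambda>x::'a. x ^ e) (subfield_Fq (Suc n))"
  proof (rule inj_onI)
    fix x y :: 'a
    assume xy: "x \<in> subfield_Fq (Suc n)" "y \<in> subfield_Fq (Suc n)" and eq: "x ^ e = y ^ e"
    show "x = y"
    proof (cases "y = 0")
      case True
      then show ?thesis using eq \<open>e > 0\<close> by (simp add: zero_power)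
    next
      case False
      then have "x \<noteq> 0" using eq \<open>e > 0\<close> by (auto simp: zero_power)
      define z where "z = x / y"
      have "z ^ e = 1" using eq False by (simp add: z_def power_divide)
      have "x ^ n = 1" "y ^ n = 1"
        using xy \<open>x \<noteq> 0\<close> False by (auto simp: subfield_Fq_def)
      then have "z ^ n = 1" by (simp add: z_def power_divide)
      obtain s t where "e * s = n * t + 1"
        using bezout_nat[of e n] \<open>e > 0\<close> \<open>coprime e n\<close> by (auto simp: coprime_iff_gcd_eq_1)
      then have "z ^ (e * s) = z ^ (n * t) * z" by simp
      then have "z = 1"
        using \<open>z ^ e = 1\<close> \<open>z ^ n = 1\<close> by (simp add: power_mult)
      then show ?thesis using False by (simp add: z_def)
    qed
  qed
qed

lemma bij_power_iff:
  assumes "e > 0"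
  shows "bij (\<lambda>x::'a::{field,finite}. x ^ e) \<longleftrightarrow> coprime e (CARD('a) - 1)"
proof -
  have "finite (UNIV :: 'a set)" "{0, 1 :: 'a} \<subseteq> UNIV" by auto
  from card_mono[OF this] have two: "CARD('a) > 1" by simp
  then have "Suc (CARD('a) - 1) = CARD('a)" by simp
  then have "subfield_Fq (Suc (CARD('a) - 1)) = (UNIV :: 'a set)"
    by (simp only: subfield_Fq_def power_card) auto
  moreover have "inj (\<lambda>x::'a. x ^ e) \<Longrightarrow> bij (\<lambda>x::'a. x ^ e)"
    by (simp add: bij_def finite_UNIV_inj_surj)
  ultimately show ?thesis
    using inj_on_power_subfield_iff[of "CARD('a) - 1" e, where ?'a='a] two assms
    by (auto simp: bij_def)
qed

section \<open>Linear equivalence, the trilinear form and the arithmetic of exponents\<close>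

lemma linear_equivalent_bij_iff:
  assumes "linear_equivalent F X P"
  shows "bij F \<longleftrightarrow> bij_betw P X X"
proof -
  from assms obtain L1 L2 where L: "bij_betw L2 UNIV X" "bij_betw L1 X UNIV"
    and F: "F = L1 \<circ> P \<circ> L2" and P: "P \<in> X \<rightarrow> X"
    by (auto simp: linear_equivalent_def additive_bij_betw_def)
  have "bij F \<longleftrightarrow> bij_betw (L1 \<circ> P) X UNIV"
    unfolding F by (rule bij_betw_comp_iff[OF L(1), symmetric])
  also have "\<dots> \<longleftrightarrow> bij_betw P X X"
    using P by (intro bij_betw_comp_iff2[OF L(2), symmetric]) auto
  finally show ?thesis .
qed

lemma tensor_identity:
  fixes w :: "'a::field"
  assumes "(2::'a) = 0" and "w^2 + w + 1 = 0"
  shows "a' * b' * c + a' * b * c' + a' * b * c + a * b' * c' + a * b * c =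
    w * (a + w * a') * (b + w^2 * b') * (c + w^2 * c')
    + w^2 * (a + w^2 * a') * (b + w * b') * (c + w * c')"
proof -
  have "w^3 - 1 = (w - 1) * (w^2 + w + 1)"
    by (simp add: power2_eq_square power3_eq_cube algebra_simps)
  then have w3: "w^3 = 1" using assms(2) by simp
  have "w + w^2 = (w^2 + w + 1) + 1 - 2" by simp
  then have w1: "w + w^2 = 1" using assms by simp
  have "w^2 + w^4 = w^2 + w^3 * w" "w^4 + w^5 = w^3 * (w + w^2)"
    by (simp_all add: power_numeral_reduce algebra_simps)
  then have coeffs: "w + w^2 = 1" "w^2 + w^4 = 1" "w^4 + w^5 = 1"
    using w1 by (simp_all add: w3 add.commute)
  \<comment> \<open>Sorted by monomials: the five wanted ones get coefficients equal to 1 by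
    \<open>coeffs\<close>, the three others an even multiple, which vanishes.\<close>
  have "w * (a + w * a') * (b + w^2 * b') * (c + w^2 * c')
      + w^2 * (a + w^2 * a') * (b + w * b') * (c + w * c') =
      (w + w^2) * (a * b * c) + (w^2 + w^4) * (a' * b * c) + (w^4 + w^5) * (a * b' * c')
      + (w^4 + w^5) * (a' * b * c') + (w^4 + w^5) * (a' * b' * c)
      + 2 * w^3 * (a * b * c') + 2 * w^3 * (a * b' * c) + 2 * w^6 * (a' * b' * c')"
    by algebra
  then show ?thesis
    unfolding coeffs assms(1) by (simp add: algebra_simps)
qed

text \<open>Split \<open>q^2 - 1\<close> as \<open>(q - 1) * (q + 1)\<close>. The exponent is
  congruent to \<open>E\<close> modulo \<open>q - 1\<close>, and to \<open>E - 2 * r\<close> modulo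
  \<open>q + 1\<close> because there \<open>q - 1\<close> is congruent to -2.\<close>

lemma coprime_exponent_iff:
  fixes q E r :: nat
  assumes "q > 0"
  shows "coprime (E + r * (q - 1)) (q^2 - 1) \<longleftrightarrow>
    gcd E (q - 1) = 1 \<and> gcd (int E - 2 * int r) (int q + 1) = 1"
proof -
  have "q^2 - 1 = (q - 1) * (q + 1)"
    by (simp add: power2_eq_square algebra_simps)
  then have "coprime (E + r * (q - 1)) (q^2 - 1) \<longleftrightarrow>
      coprime (E + r * (q - 1)) (q - 1) \<and> coprime (E + r * (q - 1)) (q + 1)"
    by (simp only: coprime_mult_right_iff)
  also have "coprime (E + r * (q - 1)) (q - 1) \<longleftrightarrow> gcd E (q - 1) = 1"
    using gcd_add_mult[of "q - 1" r E]
    by (simp only: coprime_iff_gcd_eq_1 gcd.commute[of _ "q - 1"] add.commute[of E])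
  also have "coprime (E + r * (q - 1)) (q + 1) \<longleftrightarrow>
      coprime (int (E + r * (q - 1))) (int (q + 1))"
    by (rule coprime_int_iff[symmetric])
  also have "int (E + r * (q - 1)) = (int E - 2 * int r) + int r * (int q + 1)"
    using assms by (simp add: of_nat_diff right_diff_distrib) (simp add: algebra_simps)
  also have "coprime \<dots> (int (q + 1)) \<longleftrightarrow> gcd (int E - 2 * int r) (int q + 1) = 1"
    using gcd_add_mult[of "int q + 1" "int r" "int E - 2 * int r"]
    by (simp add: coprime_iff_gcd_eq_1 gcd.commute[of _ "int q + 1"] add.commute[of "int E - _"]
        add.commute[of 1] del: gcd_add_mult)
  finally show ?thesis .
qed

lemma additive_bij_betw_comp:
  assumes "additive_bij_betw f A B" and "additive_bij_betw g B C"
  shows "additive_bij_betw (g \<circ> f) A C"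
  using assms by (auto simp: additive_bij_betw_def bij_betw_apply intro: bij_betw_trans)

lemma linear_equivalentI:
  assumes "P \<in> X \<rightarrow> X" and "additive_bij_betw L1 X UNIV" and "additive_bij_betw L2 UNIV X"
    and "\<And>x. F x = L1 (P (L2 x))"
  shows "linear_equivalent F X P"
  unfolding linear_equivalent_def using assms
  by (intro conjI exI[of _ L1] exI[of _ L2]) (auto simp: fun_eq_iff)

section \<open>Conjugation and cube roots of unity in the quadratic extension\<close>

locale char2_quadratic_extension =
  fixes m q :: nat and w :: "'a::{field,finite}"
  assumes m_pos: "m > 0" and q_eq: "q = 2 ^ m"
    and card_UNIV_eq: "CARD('a) = q ^ 2"
    and w_root: "w^2 + w + 1 = 0"
begin

definition bar :: "'a \<Rightarrow> 'a" where
  "bar x = x ^ q"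

text \<open>This is the linear form \<open>t\<close>. For even \<open>m\<close> it is used twice: as
  the inner change of coordinates and as the outer map that takes \<open>z\<close> to
  \<open>z + w\<^sup>2 * bar z\<close>.\<close>

definition twist :: "'a \<Rightarrow> 'a" where
  "twist x = x + w^2 * bar x"

lemma two_eq_0: "(2::'a) = 0"
proof -
  have "even CARD('a)" using m_pos by (simp add: card_UNIV_eq q_eq)
  then have "(1::'a) = - 1" using power_card[of "- 1 :: 'a"] by simp
  then have "(1::'a) + 1 = 0" by (simp add: eq_neg_iff_add_eq_0)
  then show ?thesis by simp
qed

lemma add_self [simp]: "x + x = (0::'a)"
  using two_eq_0 by (simp flip: mult_2)

lemma add_self_left [simp]: "x + (x + y) = (y::'a)"
  by (simp flip: add.assoc)

lemma add_eq_0_iff_eq: "x + y = (0::'a) \<longleftrightarrow> x = y"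
  by (metis add_self add_left_imp_eq)

lemma power_2_power_add: "(x + y :: 'a) ^ (2 ^ k) = x ^ (2 ^ k) + y ^ (2 ^ k)"
proof (induction k)
  case (Suc k)
  have "(x + y) ^ (2 ^ Suc k) = ((x + y) ^ 2 ^ k)\<^sup>2"
    by (simp add: mult.commute flip: power_mult)
  also have "\<dots> = (x ^ 2 ^ k)\<^sup>2 + (y ^ 2 ^ k)\<^sup>2"
    by (simp add: Suc.IH power2_sum two_eq_0)
  finally show ?case
    by (simp add: mult.commute flip: power_mult)
qed simp

lemma w_squared: "w\<^sup>2 = w + 1"
  using w_root by (simp add: add_eq_0_iff_eq add.assoc)

lemma w_cubed: "w ^ 3 = 1"
proof -
  have "w^3 - 1 = (w - 1) * (w^2 + w + 1)"
    by algebra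
  then show ?thesis using w_root by simp
qed

lemma w_neq_0: "w \<noteq> 0" and w_neq_1: "w \<noteq> 1"
  using w_root by auto

lemma w_fourth: "w ^ 4 = w"
proof -
  have "w ^ 4 = w ^ 3 * w" by algebra
  then show ?thesis by (simp add: w_cubed)
qed

text \<open>Rewrite rules for right-nested products: these cancel cubes of \<open>w\<close> in
  monomials, while \<open>w_mult_w\<close> reduces sums to the basis 1, \<open>w\<close>.\<close>

lemma w_mult_cycle: "w * (w * w) = 1" "w * (w * (w * x)) = x"
proof -
  show "w * (w * w) = 1" using w_cubed by (simp add: power3_eq_cube mult.assoc)
  then show "w * (w * (w * x)) = x" by (metis mult.assoc mult_1_left)
qed

lemma w_mult_w: "w * w = 1 + w" "w * (w * x) = x + w * x"
proof -
  show "w * w = 1 + w" using w_squared by (simp add: power2_eq_square add.commute)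
  then show "w * (w * x) = x + w * x" by (simp add: distrib_right flip: mult.assoc)
qed

lemma w_power_2_power: "w ^ (2 ^ k) = (if even k then w else w\<^sup>2)"
proof (induction k)
  case (Suc k)
  have "w ^ (2 ^ Suc k) = (w ^ 2 ^ k)\<^sup>2"
    by (simp add: mult.commute flip: power_mult)
  then show ?case
    by (simp add: Suc.IH w_fourth)
qed simp

lemma w2_power_2_power: "(w\<^sup>2) ^ (2 ^ k) = (if even k then w\<^sup>2 else w)"
proof -
  have "(w\<^sup>2) ^ (2 ^ k) = (w ^ (2 ^ k))\<^sup>2" by (simp add: mult.commute flip: power_mult)
  then show ?thesis by (simp add: w_power_2_power w_fourth)
qed

lemma bar_add: "bar (x + y) = bar x + bar y"
  unfolding bar_def unfolding q_eq by (rule power_2_power_add)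

lemma bar_mult: "bar (x * y) = bar x * bar y"
  by (simp add: bar_def power_mult_distrib)

lemma bar_power: "bar (x ^ k) = bar x ^ k"
  by (simp add: bar_def mult.commute flip: power_mult)

lemma bar_bar: "bar (bar x) = x"
  using power_card[of x] by (simp add: bar_def card_UNIV_eq power2_eq_square power_mult)

lemma bar_w: "bar w = (if even m then w else w\<^sup>2)"
  unfolding bar_def unfolding q_eq by (rule w_power_2_power)

lemma mem_subfield_Fq_iff: "x \<in> subfield_Fq q \<longleftrightarrow> bar x = x"
  by (simp add: subfield_Fq_def bar_def)

lemma additive_bij_betw_bar: "additive_bij_betw bar UNIV UNIV"
  unfolding additive_bij_betw_def
  by (intro conjI bij_betw_byWitness[where f' = bar]) (auto simp: bar_add bar_bar)

lemma additive_bij_betw_mult: "c \<noteq> 0 \<Longrightarrow> additive_bij_betw (\<lambda>x::'a. c * x) UNIV UNIV"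
  unfolding additive_bij_betw_def
  by (intro conjI bij_betw_byWitness[where f' = "\<lambda>x. x / c"]) (auto simp: distrib_left)

text \<open>For even \<open>m\<close>, \<open>w\<close> is fixed by \<open>bar\<close>. Conjugating
  the kernel equation \<open>x = w\<^sup>2 * bar x\<close> and substituting it into itself gives
  \<open>x = w * x\<close>, hence \<open>x = 0\<close>.\<close>

lemma additive_bij_betw_twist:
  assumes "even m"
  shows "additive_bij_betw twist UNIV UNIV"
proof -
  have add: "twist (x + y) = twist x + twist y" for x y
    by (simp add: twist_def bar_add algebra_simps)
  have kernel: "x = 0" if "twist x = 0" for x
  proof -
    have x: "x = w\<^sup>2 * bar x" using that by (simp add: twist_def add_eq_0_iff_eq)
    then have "bar x = bar (w\<^sup>2 * bar x)" by simp
    also have "\<dots> = w\<^sup>2 * x" using assms by (simp add: bar_mult bar_power bar_w bar_bar)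
    finally have "x = w\<^sup>2 * (w\<^sup>2 * x)" using x by simp
    also have "\<dots> = w ^ 4 * x" by algebra
    finally have "x = w * x" by (simp only: w_fourth)
    then show "x = 0" using w_neq_1 by simp
  qed
  have "inj twist"
  proof (rule injI)
    fix x y assume "twist x = twist y"
    then have "twist (x + y) = 0" by (simp add: add)
    then have "x + y = 0" by (rule kernel)
    then show "x = y" by (simp only: add_eq_0_iff_eq)
  qed
  then have "bij twist" by (simp add: bij_def finite_UNIV_inj_surj)
  with add show ?thesis by (simp add: additive_bij_betw_def)
qed

section \<open>The polynomial in the coordinates \<open>s\<close> and \<open>t\<close>\<close>

lemma twisted_power:
  assumes "Q = 2 ^ k"
  shows "x ^ Q + w * bar x ^ Q = (if even k then x + w * bar x else x + w\<^sup>2 * bar x) ^ Q"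
    and "x ^ Q + w\<^sup>2 * bar x ^ Q = (if even k then x + w\<^sup>2 * bar x else x + w * bar x) ^ Q"
  by (simp_all add: assms power_2_power_add power_mult_distrib w_power_2_power w2_power_2_power)

text \<open>In each product of \<open>tensor_identity\<close> the factors for \<open>Q1\<close> and
  \<open>Q2\<close> carry opposite cube roots of unity, so the case distinction on \<open>j\<close>
  is reversed relative to that on \<open>i\<close>.\<close>

lemma poly_f_B_eq:
  fixes x :: 'a
  assumes "Q1 = 2 ^ i" and "Q2 = 2 ^ j"
  defines "s \<equiv> x + w * bar x" and "t \<equiv> x + w\<^sup>2 * bar x"
  shows "poly (f_B q Q1 Q2) x =
    w * (if even i then s else t) ^ Q1 * (if even j then t else s) ^ Q2 * t
    + w\<^sup>2 * (if even i then t else s) ^ Q1 * (if even j then s else t) ^ Q2 * s"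
proof -
  have "poly (f_B q Q1 Q2) x = bar x ^ Q1 * bar x ^ Q2 * x + bar x ^ Q1 * x ^ Q2 * bar x
    + bar x ^ Q1 * x ^ Q2 * x + x ^ Q1 * bar x ^ Q2 * bar x + x ^ Q1 * x ^ Q2 * x"
    unfolding f_B_def poly_add poly_monom bar_def power_add power_mult power_one_right
    by (simp only: mult_ac add_ac mult_1_left)
  also have "\<dots> = w * (x ^ Q1 + w * bar x ^ Q1) * (x ^ Q2 + w\<^sup>2 * bar x ^ Q2) * t
    + w\<^sup>2 * (x ^ Q1 + w\<^sup>2 * bar x ^ Q1) * (x ^ Q2 + w * bar x ^ Q2) * s"
    unfolding s_def t_def by (rule tensor_identity[OF two_eq_0 w_root])
  finally show ?thesis
    unfolding s_def t_def twisted_power[OF assms(1)] twisted_power[OF assms(2)] .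
qed

text \<open>This explains the exponent \<open>r_B i j * (q - 1)\<close>: adding
  \<open>b * (q - 1)\<close> to the exponent conjugates \<open>b\<close> of the factors.\<close>

lemma power_bar_exponent:
  "x ^ (a + b + b * (q - 1)) = x ^ a * bar x ^ b"
proof -
  have "a + b + b * (q - 1) = a + q * b"
    using q_eq by (simp add: algebra_simps)
  then show ?thesis by (simp only: bar_def power_add power_mult)
qed

section \<open>Even \<open>m\<close>: a monomial on the whole field\<close>

lemma poly_f_B_even:
  fixes x :: 'a
  assumes "even m" and Q: "Q1 = 2 ^ i" "Q2 = 2 ^ j"
  defines "y \<equiv> twist x"
  shows "poly (f_B q Q1 Q2) x = twist
    (if even i then if even j then w\<^sup>2 * (bar y ^ Q1 * y ^ Q2 * y)
                              else w * (bar y ^ Q1 * bar y ^ Q2 * y)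
     else if even j then w * (y ^ Q1 * y ^ Q2 * y)
                    else y ^ Q1 * bar y ^ Q2 * y)"
proof -
  have bar_w_even: "bar w = w" using \<open>even m\<close> by (simp add: bar_w)
  have s: "x + w * bar x = w * bar y"
  proof -
    have "bar y = bar x + w\<^sup>2 * x"
      by (simp add: y_def twist_def bar_add bar_mult bar_power bar_w_even bar_bar)
    moreover have "w * (bar x + w\<^sup>2 * x) = w * bar x + w ^ 3 * x"
      by algebra
    ultimately show ?thesis by (simp only: w_cubed mult_1_left add.commute)
  qed
  have t: "x + w\<^sup>2 * bar x = y" by (simp add: y_def twist_def)
  \<comment> \<open>By \<open>s\<close> and \<open>t\<close>, the first product of
    \<open>poly_f_B_eq\<close> is a monomial in \<open>y\<close> and \<open>bar y\<close>. Its
    constant is the leading \<open>w\<close> times a power of \<open>w\<close> from each factor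
    \<open>w * bar y\<close>. The second product is \<open>w\<^sup>2\<close> times the conjugate of
    the first.\<close>
  note rules = poly_f_B_eq[OF Q, of x, unfolded s t] twist_def bar_mult bar_power bar_bar bar_w_even
    power_mult_distrib w_power_2_power[of i, folded Q] w_power_2_power[of j, folded Q]
  consider "even i" "even j" | "even i" "odd j" | "odd i" "even j" | "odd i" "odd j"
    by blast
  then show ?thesis
    by cases (simp only: rules if_True if_False not_False_eq_True simp_thms,
      simp add: power2_eq_square mult_ac w_mult_cycle)+
qed

lemma linear_equivalent_even:
  assumes "even m" and Q: "Q1 = 2 ^ i" "Q2 = 2 ^ j"
  shows "linear_equivalent (poly (f_B q Q1 Q2 :: 'a poly)) (UNIV :: 'a set)
           (\<lambda>x. x ^ (Q1 + Q2 + 1 + r_B i j * (q - 1)))"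
proof -
  let ?P = "\<lambda>x::'a. x ^ (Q1 + Q2 + 1 + r_B i j * (q - 1))"
  note twist_bij = additive_bij_betw_twist[OF \<open>even m\<close>]
  note bar_twist_bij = additive_bij_betw_comp[OF twist_bij additive_bij_betw_bar]
  note f = poly_f_B_even[OF \<open>even m\<close> Q]
  have P: "?P x = x ^ a * bar x ^ b" if "Q1 + Q2 + 1 = a + b" "r_B i j = b" for x a b
    unfolding that by (rule power_bar_exponent)
  have equivalent: "linear_equivalent (poly (f_B q Q1 Q2 :: 'a poly)) (UNIV :: 'a set) ?P"
    if "c \<noteq> 0" "L = twist \<or> L = bar \<circ> twist" "\<And>x. poly (f_B q Q1 Q2) x = twist (c * ?P (L x))"
    for c L
  proof (rule linear_equivalentI[where ?L1.0 = "twist \<circ> (\<lambda>x. c * x)" and ?L2.0 = L])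
    show "additive_bij_betw (twist \<circ> (\<lambda>x. c * x)) (UNIV :: 'a set) UNIV"
      by (rule additive_bij_betw_comp[OF additive_bij_betw_mult[OF that(1)] twist_bij])
    show "additive_bij_betw L UNIV UNIV"
      using that(2) twist_bij bar_twist_bij by blast
    show "poly (f_B q Q1 Q2) x = (twist \<circ> (\<lambda>x. c * x)) (?P (L x))" for x
      unfolding comp_apply by (rule that(3))
  qed simp
  \<comment> \<open>In each case \<open>r_B i j\<close> is the smaller of the exponents of
    \<open>y\<close> and \<open>bar y\<close> in \<open>poly_f_B_even\<close>. If it belongs to
    \<open>y\<close>, the inner map is \<open>bar \<circ> twist\<close>, which exchanges the
    two.\<close>
  consider "odd i" "even j" | "even i" "odd j"
    | "even i" "even j" "Q1 \<le> Q2" | "even i" "even j" "Q1 > Q2"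
    | "odd i" "odd j" "Q1 < Q2" | "odd i" "odd j" "Q1 \<ge> Q2"
    by linarith
  then show ?thesis
  proof cases
    case 1
    have r: "r_B i j = 0"
      using 1 by (simp add: r_B_def Q)
    have "poly (f_B q Q1 Q2) x = twist (w * ?P (twist x))" for x
      using 1 by (subst P[of "Q1 + Q2 + 1" 0]) (simp_all add: r f power_add bar_bar mult_ac)
    then show ?thesis by (rule equivalent[rotated 2]) (simp_all add: w_neq_0 fun_eq_iff)
  next
    case 2
    have r: "r_B i j = 1"
      using 2 by (simp add: r_B_def Q)
    have "poly (f_B q Q1 Q2) x = twist (w * ?P ((bar \<circ> twist) x))" for x
      using 2 by (subst P[of "Q1 + Q2" 1]) (simp_all add: r f power_add bar_bar mult_ac)
    then show ?thesis by (rule equivalent[rotated 2]) (simp_all add: w_neq_0 fun_eq_iff)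
  next
    case 3
    have r: "r_B i j = Q1"
      using 3 by (simp add: r_B_def Q)
    have "poly (f_B q Q1 Q2) x = twist (w\<^sup>2 * ?P (twist x))" for x
      using 3 by (subst P[of "Q2 + 1" Q1]) (simp_all add: r f power_add bar_bar mult_ac)
    then show ?thesis by (rule equivalent[rotated 2]) (simp_all add: w_neq_0 fun_eq_iff)
  next
    case 4
    have r: "r_B i j = Q2 + 1"
      using 4 by (simp add: r_B_def Q)
    have "poly (f_B q Q1 Q2) x = twist (w\<^sup>2 * ?P ((bar \<circ> twist) x))" for x
      using 4 by (subst P[of "Q1" "Q2 + 1"]) (simp_all add: r f power_add bar_bar mult_ac)
    then show ?thesis by (rule equivalent[rotated 2]) (simp_all add: w_neq_0 fun_eq_iff)
  next
    case 5
    have r: "r_B i j = Q1 + 1"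
      using 5 by (simp add: r_B_def Q)
    have "poly (f_B q Q1 Q2) x = twist (1 * ?P ((bar \<circ> twist) x))" for x
      using 5 by (subst P[of "Q2" "Q1 + 1"]) (simp_all add: r f power_add bar_bar mult_ac)
    then show ?thesis by (rule equivalent[rotated 2]) (simp_all add: fun_eq_iff)
  next
    case 6
    have r: "r_B i j = Q2"
      using 6 by (simp add: r_B_def Q)
    have "poly (f_B q Q1 Q2) x = twist (1 * ?P (twist x))" for x
      using 6 by (subst P[of "Q1 + 1" Q2]) (simp_all add: r f power_add bar_bar mult_ac)
    then show ?thesis by (rule equivalent[rotated 2]) (simp_all add: fun_eq_iff)
  qed
qed

section \<open>Odd \<open>m\<close>: a pair of powers over the subfield, or a nonzero root\<close>

lemma linear_equivalent_odd:
  assumes "odd m" and Q: "Q1 = 2 ^ i" "Q2 = 2 ^ j" and "odd i" "even j"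
  shows "linear_equivalent (poly (f_B q Q1 Q2 :: 'a poly))
           (subfield_Fq q \<times> subfield_Fq q :: ('a \<times> 'a) set)
           (\<lambda>(u, v). (u ^ (Q1 + Q2 + 1), v ^ (Q1 + Q2 + 1)))"
proof (rule linear_equivalentI)
  define L1 :: "'a \<times> 'a \<Rightarrow> 'a" where "L1 = (\<lambda>(u, v). w * u + w\<^sup>2 * v)"
  \<comment> \<open>As \<open>bar w = w\<^sup>2\<close>, conjugation multiplies \<open>s\<close> by
    \<open>w\<^sup>2\<close> and \<open>t\<close> by \<open>w\<close>. The factors \<open>w\<close>
    and \<open>w\<^sup>2\<close> make both coordinates invariant, and \<open>L1\<close> recovers
    \<open>x\<close> from them.\<close>
  define L2 where "L2 x = (w * (x + w * bar x), w\<^sup>2 * (x + w\<^sup>2 * bar x))" for x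
  have bar_w_odd: "bar w = w * w"
    using \<open>odd m\<close> by (simp add: bar_w power2_eq_square)
  have L1_L2: "L1 (L2 x) = x" for x
    by (simp add: L1_def L2_def power2_eq_square algebra_simps w_mult_w)
  have L2_L1: "L2 (L1 p) = p" if "p \<in> subfield_Fq q \<times> subfield_Fq q" for p
    using that by (cases p)
      (simp add: L1_def L2_def mem_subfield_Fq_iff bar_add bar_mult bar_power bar_bar bar_w_odd
        power2_eq_square algebra_simps w_mult_w)
  have L2_mem: "L2 x \<in> subfield_Fq q \<times> subfield_Fq q" for x
    by (simp add: L2_def mem_subfield_Fq_iff bar_add bar_mult bar_power bar_bar bar_w_odd
        power2_eq_square algebra_simps w_mult_cycle)
  show "(\<lambda>(u, v). (u ^ (Q1 + Q2 + 1), v ^ (Q1 + Q2 + 1)))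
      \<in> (subfield_Fq q \<times> subfield_Fq q :: ('a \<times> 'a) set) \<rightarrow> subfield_Fq q \<times> subfield_Fq q"
    by (auto simp: mem_subfield_Fq_iff bar_power bar_mult)
  show "additive_bij_betw L1 (subfield_Fq q \<times> subfield_Fq q) UNIV"
    unfolding additive_bij_betw_def
    by (intro conjI bij_betw_byWitness[where f' = L2])
      (auto simp: L1_L2 L2_L1 L2_mem image_subset_iff, auto simp: L1_def algebra_simps)
  show "additive_bij_betw L2 UNIV (subfield_Fq q \<times> subfield_Fq q)"
    unfolding additive_bij_betw_def
    by (intro conjI bij_betw_byWitness[where f' = L1])
      (auto simp: L1_L2 L2_L1 L2_mem image_subset_iff, auto simp: L2_def bar_add algebra_simps)
  show "poly (f_B q Q1 Q2) x =
      L1 ((\<lambda>(u, v). (u ^ (Q1 + Q2 + 1), v ^ (Q1 + Q2 + 1))) (L2 x))" for x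
  proof -
    have wQ: "w ^ Q1 = w\<^sup>2" "w ^ Q2 = w" "(w\<^sup>2) ^ Q1 = w" "(w\<^sup>2) ^ Q2 = w\<^sup>2"
      using assms by (simp_all add: w_power_2_power w2_power_2_power)
    show ?thesis
      using \<open>odd i\<close> \<open>even j\<close>
      by (simp add: poly_f_B_eq[OF Q] L1_def L2_def power_mult_distrib power_add wQ)
        (simp add: power2_eq_square mult_ac w_mult_cycle)
  qed
qed

text \<open>The form \<open>t\<close> vanishes at \<open>w\<close>. The first product always
  contains \<open>t\<close>; the second contains it through \<open>Q1\<close> if \<open>i\<close> is
  even and through \<open>Q2\<close> if \<open>j\<close> is odd.\<close>

lemma poly_f_B_w:
  assumes "odd m" and Q: "Q1 = 2 ^ i" "Q2 = 2 ^ j" and "even i \<or> odd j"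
  shows "poly (f_B q Q1 Q2) w = 0"
proof -
  have Q12_pos: "Q1 > 0" "Q2 > 0" using Q by simp_all
  have "bar w = w\<^sup>2" using \<open>odd m\<close> by (simp add: bar_w)
  then have "w + w\<^sup>2 * bar w = 0"
    by (simp add: w_fourth flip: power_add)
  then show ?thesis
    using \<open>even i \<or> odd j\<close> Q12_pos by (auto simp: poly_f_B_eq[OF Q])
qed

end

section \<open>From power maps to the permutation criterion\<close>

lemma bij_betw_power_pair_iff:
  fixes S :: "'a::{monoid_mult,finite} set"
  assumes "\<And>x. x \<in> S \<Longrightarrow> x ^ e \<in> S" and "1 \<in> S"
  shows "bij_betw (\<lambda>(u, v). (u ^ e, v ^ e)) (S \<times> S) (S \<times> S) \<longleftrightarrow> inj_on (\<lambda>x. x ^ e) S"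
    (is "bij_betw ?P _ _ \<longleftrightarrow> _")
proof
  assume "bij_betw ?P (S \<times> S) (S \<times> S)"
  then have "inj_on ?P (S \<times> S)" by (rule bij_betw_imp_inj_on)
  then show "inj_on (\<lambda>x. x ^ e) S"
    using \<open>1 \<in> S\<close> by (auto simp: inj_on_def)
next
  assume "inj_on (\<lambda>x. x ^ e) S"
  then have "inj_on ?P (S \<times> S)" by (auto simp: inj_on_def)
  moreover have "?P ` (S \<times> S) \<subseteq> S \<times> S" using assms(1) by auto
  ultimately show "bij_betw ?P (S \<times> S) (S \<times> S)"
    by (simp add: bij_betw_def endo_inj_surj)
qed

text \<open>The field has \<open>4 ^ m\<close> elements, which is 1 modulo 3, so it contains a
  nontrivial cube root of unity whatever the parity of \<open>m\<close>.\<close>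

lemma exists_primitive_cube_root:
  assumes "CARD('a::{field,finite}) = (2 ^ m)\<^sup>2" and "m > 0"
  shows "\<exists>w::'a. w\<^sup>2 + w + 1 = 0"
proof -
  have "(2 ^ m)\<^sup>2 = (4 ^ m :: nat)"
    by (simp add: power2_eq_square flip: power_mult_distrib)
  moreover have "[4 ^ m = 1 ^ m] (mod 3 :: nat)"
    by (rule cong_pow) (simp add: cong_def)
  ultimately have "3 dvd CARD('a) - 1"
    using assms(1) by (metis cong_to_1_nat power_one)
  then obtain w :: 'a where "w \<noteq> 1" "w ^ 3 = 1"
    using exists_root_of_unity[of 3] by auto
  moreover have "(w - 1) * (w\<^sup>2 + w + 1) = w ^ 3 - 1"
    by (simp add: power2_eq_square power3_eq_cube algebra_simps)
  ultimately show ?thesis by auto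
qed

theorem theorem1p3:
  fixes m i j q Q1 Q2 :: nat
    and f :: "'a::{field,finite} poly"
  assumes "m > 0" and "i > 0" and "j > 0"
    and "q = 2 ^ m" and "Q1 = 2 ^ i" and "Q2 = 2 ^ j"
    and "CARD('a) = q ^ 2"
    and "f = f_B q Q1 Q2"
  defines "cond_i \<equiv> odd m \<and> [i * (j + 1) = 1] (mod 2) \<and> gcd (Q1 + Q2 + 1) (q - 1) = 1"
    and "cond_ii \<equiv> even m \<and> gcd (Q1 + Q2 + 1) (q - 1) = 1
           \<and> gcd (int Q1 + int Q2 + 1 - 2 * int (r_B i j)) (int q + 1) = 1"
  shows "(bij (poly f) \<longleftrightarrow> cond_i \<or> cond_ii)
    \<and> (cond_i \<longrightarrow> linear_equivalent (poly f) (subfield_Fq q \<times> subfield_Fq q :: ('a \<times> 'a) set)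
           (\<lambda>(u, v). (u ^ (Q1 + Q2 + 1), v ^ (Q1 + Q2 + 1))))
    \<and> (cond_ii \<longrightarrow> linear_equivalent (poly f) (UNIV :: 'a set)
           (\<lambda>x. x ^ (Q1 + Q2 + 1 + r_B i j * (q - 1))))"
proof -
  obtain w :: 'a where "w\<^sup>2 + w + 1 = 0"
    using exists_primitive_cube_root assms by blast
  then interpret char2_quadratic_extension m q w
    using assms by unfold_locales auto
  note Q = \<open>Q1 = 2 ^ i\<close> \<open>Q2 = 2 ^ j\<close>
  have cong_iff: "[i * (j + 1) = 1] (mod 2) \<longleftrightarrow> odd i \<and> even j"
  proof -
    have "[k = 1] (mod 2) \<longleftrightarrow> odd k" for k :: nat
      by (simp only: cong_def odd_iff_mod_2_eq_one one_mod_two_eq_one)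
    then show ?thesis by (simp only: even_mult_iff even_add) simp
  qed
  have "q > 1"
    unfolding \<open>q = 2 ^ m\<close> by (rule one_less_power) (use \<open>m > 0\<close> in simp_all)
  show ?thesis
  proof (cases "even m")
    case True
    note equiv = linear_equivalent_even[OF True Q]
    have "bij (poly f) \<longleftrightarrow> coprime (Q1 + Q2 + 1 + r_B i j * (q - 1)) (CARD('a) - 1)"
      unfolding \<open>f = _\<close> linear_equivalent_bij_iff[OF equiv]
      by (rule bij_power_iff) simp
    also have "\<dots> \<longleftrightarrow> cond_ii"
      unfolding \<open>CARD('a) = q ^ 2\<close> cond_ii_def
      using coprime_exponent_iff[of q "Q1 + Q2 + 1" "r_B i j"] \<open>q > 1\<close> True by (simp add: algebra_simps)
    finally show ?thesis
      using equiv True by (simp add: cond_i_def \<open>f = _\<close>)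
  next
    case False
    then have not_ii: "\<not> cond_ii" by (simp add: cond_ii_def)
    show ?thesis
    proof (cases "odd i \<and> even j")
      case True
      then have equiv: "linear_equivalent (poly f) (subfield_Fq q \<times> subfield_Fq q :: ('a \<times> 'a) set)
           (\<lambda>(u, v). (u ^ (Q1 + Q2 + 1), v ^ (Q1 + Q2 + 1)))"
        using linear_equivalent_odd[OF False Q] \<open>f = _\<close> by simp
      have "bij (poly f) \<longleftrightarrow> inj_on (\<lambda>x::'a. x ^ (Q1 + Q2 + 1)) (subfield_Fq q)"
        unfolding linear_equivalent_bij_iff[OF equiv]
        by (rule bij_betw_power_pair_iff) (simp_all only: mem_subfield_Fq_iff bar_power, simp_all add: bar_def)
      also have "\<dots> \<longleftrightarrow> coprime (Q1 + Q2 + 1) (q - 1)"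
      proof -
        have "CARD('a) - 1 = (q - 1) * (q + 1)"
          unfolding \<open>CARD('a) = q ^ 2\<close> by (simp add: power2_eq_square algebra_simps)
        then have "q - 1 dvd CARD('a) - 1" by simp
        then show ?thesis
          using inj_on_power_subfield_iff[of "q - 1" "Q1 + Q2 + 1", where ?'a='a] \<open>q > 1\<close> by simp
      qed
      also have "\<dots> \<longleftrightarrow> cond_i"
        unfolding cond_i_def cong_iff using False True by (simp add: coprime_iff_gcd_eq_1)
      finally show ?thesis using equiv not_ii by simp
    next
      case parity: False
      \<comment> \<open>Two distinct zeros, 0 and \<open>w\<close>, rule out a permutation.\<close>
      have "poly f 0 = 0"
        using Q by (simp add: \<open>f = _\<close> f_B_def poly_monom power_0_left)
      moreover have "poly f w = 0"
        unfolding \<open>f = _\<close> using False parity by (intro poly_f_B_w[OF _ Q]) auto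
      ultimately have "\<not> bij (poly f)"
        using w_neq_0 by (metis bij_pointE)
      moreover have "\<not> cond_i" unfolding cond_i_def cong_iff using parity by blast
      ultimately show ?thesis using not_ii by simp
    qed
  qed
qed

end
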